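(* Let $a>0$, $b>0$. Then $\left(a,\,b,\,a+b-\frac12\right)\in\mathcal{P}_{1,2}$ if and only if $b>a+\frac12$. Moreover, in this case, for all $x>0$, $${}_1F_2\left(a\,;b,\,a+b-\tfrac12\,;-\tfrac{x^2}{4}\right)>\mathbb{J}_{b-1}^2\left(\frac{x}{2}\right).$$
   Context: For $a,b,c>0$, ${}_1F_2\left(a\,;b,c\,;-\frac{x^2}{4}\right)=\sum_{k=0}^\infty \frac{(a)_k}{k!\,(b)_k(c)_k}\left(-\frac{x^2}{4}\right)^k$, where $(\alpha)_k=\Gamma(\alpha+k)/\Gamma(\alpha)$. $\mathcal{P}_{1,2}$ denotes the set of all triples $(a,b,c)$ of positive reals such that this function is $>0$ for all $x>0$. For $\alpha>-1$, $\mathbb{J}_\alpha(x)={}_0F_1\left(\alpha+1\,;-\frac{x^2}{4}\right)=\Gamma(\alpha+1)(x/2)^{-\alpha}J_\alpha(x)$, with $J_\alpha$ the Bessel function of the first kind. *)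

theory Defs
  imports "HOL-Analysis.Analysis"
begin

definition hyp1F2 :: "real \<Rightarrow> real \<Rightarrow> real \<Rightarrow> real \<Rightarrow> real" where
  "hyp1F2 a b c z =
     (\<Sum>k. pochhammer a k / (fact k * pochhammer b k * pochhammer c k) * z ^ k)"

definition hyp0F1 :: "real \<Rightarrow> real \<Rightarrow> real" where
  "hyp0F1 b z = (\<Sum>k. z ^ k / (fact k * pochhammer b k))"

definition normJ :: "real \<Rightarrow> real \<Rightarrow> real" where
  "normJ \<alpha> x = hyp0F1 (\<alpha> + 1) (- (x ^ 2) / 4)"

definition P12 :: "(real \<times> real \<times> real) set" where
  "P12 = {(a, b, c). a > 0 \<and> b > 0 \<and> c > 0 \<and>
            (\<forall>x::real. x > 0 \<longrightarrow> hyp1F2 a b c (- (x ^ 2) / 4) > 0)}"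

end

theory Submission
  imports Defs
begin

text \<open>
  Write \<open>F a b\<close> for the function \<open>\<^sub>1F\<^sub>2(a; b, a + b - 1/2; -x\<^sup>2/4)\<close>. Gasper's method expands it, for \<open>b > 1/2\<close>,
  in squares of Bessel functions:
  \<open>F a b = \<Sum>\<^sub>n g\<^sub>n (x/2)\<^bsup>2n\<^esup> \<J>\<^bsub>b-1+n\<^esub>(x/2)\<^sup>2\<close>, where \<open>g\<^sub>0 = 1\<close> and \<open>g\<^sub>n\<close> is a positive multiple of
  \<open>(b - a - 1/2)\<^sub>n\<close>. Comparing coefficients of powers of \<open>x\<close>, this is a terminating very well-poised
  \<open>\<^sub>5F\<^sub>4\<close> sum in which one pair of parameters cancels. If \<open>b > a + 1/2\<close>, all \<open>g\<^sub>n\<close> are positive, which gives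
  the inequality. If \<open>b = a + 1/2\<close>, only the term \<open>n = 0\<close> survives, so \<open>F a b\<close> is the square of a Bessel
  function and has a zero. If \<open>b < a + 1/2\<close> and \<open>F a b\<close> were positive, then Euler's Beta integral, which
  raises a lower parameter and preserves positivity, applied to both lower parameters would make
  \<open>F a (a + 1/2)\<close> positive.
\<close>

section \<open>Pochhammer bounds and convergence of the series\<close>

lemma pochhammer_le_power_mult:
  fixes a b M :: real
  assumes "0 < a" "0 < b" "a \<le> M * b" "1 \<le> M"
  shows "pochhammer a n \<le> M ^ n * pochhammer b n"
proof (induction n)
  case (Suc n)
  have "a + n \<le> M * (b + n)"
    using assms mult_right_mono[of 1 M "real n"] by (simp add: algebra_simps)
  with Suc have "pochhammer a n * (a + n) \<le> (M ^ n * pochhammer b n) * (M * (b + n))"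
    using assms by (intro mult_mono) (auto intro!: mult_nonneg_nonneg pochhammer_nonneg)
  thus ?case by (simp add: pochhammer_Suc mult_ac)
qed simp

lemma power_le_pochhammer:
  fixes b :: real
  assumes "0 < b"
  shows "b ^ n \<le> pochhammer b n"
proof (induction n)
  case (Suc n)
  with assms have "b ^ n * b \<le> pochhammer b n * (b + n)"
    by (intro mult_mono) (auto intro!: pochhammer_nonneg)
  thus ?case by (simp add: pochhammer_Suc mult_ac)
qed simp

lemma abs_pochhammer_le:
  fixes x c :: real
  assumes "\<bar>x\<bar> \<le> c"
  shows "\<bar>pochhammer x n\<bar> \<le> pochhammer c n"
proof (induction n)
  case (Suc n)
  have "\<bar>pochhammer x n\<bar> * \<bar>x + n\<bar> \<le> pochhammer c n * (c + n)"
    using Suc assms by (intro mult_mono) auto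
  thus ?case by (simp add: pochhammer_Suc abs_mult)
qed simp

lemma summable_exp_real: "summable (\<lambda>k. (x::real) ^ k / fact k)"
  using summable_exp[of x] by (simp add: field_simps)

text \<open>The quotient (a)_k / (b)_k grows at most geometrically and 1 / (c)_k is at most c^(-k),
  so the remaining 1 / k! permits comparison with an exponential series.\<close>

lemma abs_summable_hyp1F2:
  fixes a b c z :: real
  assumes "a > 0" "b > 0" "c > 0"
  shows "summable (\<lambda>k. \<bar>pochhammer a k / (fact k * pochhammer b k * pochhammer c k) * z ^ k\<bar>)"
proof (rule summable_comparison_test'[OF summable_exp_real[of "(1 + a / b) / c * \<bar>z\<bar>"]])
  fix k :: nat
  have 1: "pochhammer a k \<le> (1 + a / b) ^ k * pochhammer b k"
    using assms by (intro pochhammer_le_power_mult) (auto simp: field_simps)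
  have 2: "c ^ k \<le> pochhammer c k" using assms by (intro power_le_pochhammer)
  have pos: "pochhammer a k > 0" "pochhammer b k > 0" "pochhammer c k > 0"
    using assms by (auto intro!: pochhammer_pos)
  have "pochhammer a k / (pochhammer b k * pochhammer c k) \<le> (1 + a / b) ^ k / c ^ k"
  proof -
    have "pochhammer a k / pochhammer b k \<le> (1 + a / b) ^ k"
      using 1 pos by (simp add: field_simps)
    moreover have "1 / pochhammer c k \<le> 1 / c ^ k"
      using 2 pos assms by (intro divide_left_mono) auto
    ultimately have "pochhammer a k / pochhammer b k * (1 / pochhammer c k) \<le> (1 + a / b) ^ k * (1 / c ^ k)"
      using pos assms by (intro mult_mono) auto
    thus ?thesis by simp
  qed
  hence "pochhammer a k / (pochhammer b k * pochhammer c k) * (\<bar>z\<bar> ^ k / fact k) \<le>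
           (1 + a / b) ^ k / c ^ k * (\<bar>z\<bar> ^ k / fact k)"
    by (rule mult_right_mono) auto
  thus "norm \<bar>pochhammer a k / (fact k * pochhammer b k * pochhammer c k) * z ^ k\<bar>
          \<le> ((1 + a / b) / c * \<bar>z\<bar>) ^ k / fact k"
    using pos by (simp add: abs_mult power_abs power_mult_distrib power_divide mult_ac)
qed

lemma summable_hyp1F2:
  fixes a b c z :: real
  assumes "a > 0" "b > 0" "c > 0"
  shows "summable (\<lambda>k. pochhammer a k / (fact k * pochhammer b k * pochhammer c k) * z ^ k)"
  by (rule summable_norm_cancel) (simp only: real_norm_def abs_summable_hyp1F2[OF assms])

lemma norm_hyp0F1_term_le:
  fixes b z :: real
  assumes "b > 0"
  shows "norm (z ^ k / (fact k * pochhammer b k)) \<le> (\<bar>z\<bar> / b) ^ k / fact k"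
proof -
  have "b ^ k \<le> pochhammer b k" using assms by (rule power_le_pochhammer)
  hence "\<bar>z\<bar> ^ k / (fact k * pochhammer b k) \<le> \<bar>z\<bar> ^ k / (fact k * b ^ k)"
    using assms by (intro divide_left_mono mult_left_mono) (auto intro!: mult_pos_pos pochhammer_pos)
  thus ?thesis
    using pochhammer_pos[OF assms, of k] by (simp add: abs_mult power_abs power_divide mult_ac)
qed

lemma abs_summable_hyp0F1:
  fixes b z :: real
  assumes "b > 0"
  shows "summable (\<lambda>k. norm (z ^ k / (fact k * pochhammer b k)))"
  by (rule summable_comparison_test'[OF summable_exp_real[of "\<bar>z\<bar> / b"]])
     (use norm_hyp0F1_term_le[OF assms] in auto)

lemma summable_hyp0F1:
  fixes b z :: real
  assumes "b > 0"
  shows "summable (\<lambda>k. z ^ k / (fact k * pochhammer b k))"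
  using abs_summable_hyp0F1[OF assms] by (rule summable_norm_cancel)

section \<open>The square of a Bessel series\<close>

text \<open>Multiplied by (b)_k^2, each summand is a product of two generalised binomial
  coefficients with the same upper entry \<open>b + k - 1\<close>, so Vandermonde's convolution
  applies. The duplication formula for (2b - 1)_(2k) then gives the shape of a \<open>hyp1F2\<close>
  coefficient.\<close>

lemma sum_inverse_pochhammer_product:
  fixes b :: real
  assumes "b > 1/2"
  shows "(\<Sum>i\<le>k. 1 / (fact i * pochhammer b i) * (1 / (fact (k - i) * pochhammer b (k - i)))) =
           4 ^ k * pochhammer (b - 1/2) k / (fact k * pochhammer b k * pochhammer (2 * b - 1) k)"
proof -
  have pos: "pochhammer b j > 0" "pochhammer (2*b-1) j > 0" for j
    using assms by (auto intro!: pochhammer_pos)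
  have split: "pochhammer b k = pochhammer b i * pochhammer (b + real i) (k - i)" if "i \<le> k" for i
    using pochhammer_product[OF that, of b] by simp
  have gch: "(b + real k - 1) gchoose (k - i) = pochhammer b k / (fact (k - i) * pochhammer b i)"
    if "i \<le> k" for i
    using split[OF that] pos[of i] that
    by (simp add: gbinomial_pochhammer' of_nat_diff field_simps)
  have "(\<Sum>i\<le>k. 1 / (fact i * pochhammer b i) * (1 / (fact (k - i) * pochhammer b (k - i)))) =
        (\<Sum>i\<le>k. ((b + real k - 1) gchoose i) * ((b + real k - 1) gchoose (k - i))) / pochhammer b k ^ 2"
    unfolding sum_divide_distrib
  proof (rule sum.cong[OF refl], goal_cases)
    case (1 i)
    hence i: "i \<le> k" by simp
    have g: "(b + real k - 1) gchoose i = pochhammer b k / (fact i * pochhammer b (k - i))"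
      using gch[of "k - i"] i by simp
    show ?case unfolding gch[OF i] g using pos[of k] by (simp add: power2_eq_square)
  qed
  also have "\<dots> = ((2 * b + 2 * real k - 2) gchoose k) / pochhammer b k ^ 2"
    using gbinomial_Vandermonde[of "b + real k - 1" "b + real k - 1" k]
    by (simp add: atMost_atLeast0 algebra_simps)
  also have "(2 * b + 2 * real k - 2) gchoose k = pochhammer (2 * b - 1 + real k) k / fact k"
    by (simp add: gbinomial_pochhammer' algebra_simps)
  also have "pochhammer (2 * b - 1 + real k) k = pochhammer (2 * (b - 1/2)) (2 * k) / pochhammer (2 * b - 1) k"
    using pochhammer_product'[of "2 * b - 1" k k] pos[of k]
    by (simp add: right_diff_distrib nonzero_eq_divide_eq mult.commute flip: mult_2)
  also have "\<dots> = 4 ^ k * pochhammer (b - 1/2) k * pochhammer b k / pochhammer (2 * b - 1) k"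
    unfolding pochhammer_double by (simp add: power_mult)
  finally show ?thesis using pos[of k] by (simp add: power2_eq_square field_simps)
qed

text \<open>Cauchy product of the series with itself. It serves twice: to expand each square in
  Gasper's series, and to recognise the boundary case b = a + 1/2 as a square.\<close>

lemma hyp1F2_eq_hyp0F1_square:
  fixes b z :: real
  assumes "b > 1/2"
  shows "hyp1F2 (b - 1/2) b (2 * b - 1) z = hyp0F1 b (z / 4) ^ 2"
proof -
  have b: "b > 0" using assms by simp
  have "hyp0F1 b (z / 4) ^ 2 =
          (\<Sum>k. \<Sum>i\<le>k. (z/4) ^ i / (fact i * pochhammer b i) *
                          ((z/4) ^ (k - i) / (fact (k - i) * pochhammer b (k - i))))"
    unfolding hyp0F1_def power2_eq_square
    by (rule Cauchy_product[OF abs_summable_hyp0F1[OF b] abs_summable_hyp0F1[OF b]])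
  also have "\<dots> = hyp1F2 (b - 1/2) b (2 * b - 1) z"
    unfolding hyp1F2_def
  proof (rule suminf_cong)
    fix k
    have "(\<Sum>i\<le>k. (z/4) ^ i / (fact i * pochhammer b i) *
                    ((z/4) ^ (k - i) / (fact (k - i) * pochhammer b (k - i)))) =
          (z/4) ^ k * (\<Sum>i\<le>k. 1 / (fact i * pochhammer b i) * (1 / (fact (k - i) * pochhammer b (k - i))))"
      unfolding sum_distrib_left
    proof (rule sum.cong[OF refl], goal_cases)
      case (1 i)
      hence "(z/4) ^ k = (z/4) ^ i * (z/4) ^ (k - i)" by (simp flip: power_add)
      thus ?case by (simp del: power_divide)
    qed
    thus "(\<Sum>i\<le>k. (z/4) ^ i / (fact i * pochhammer b i) *
                    ((z/4) ^ (k - i) / (fact (k - i) * pochhammer b (k - i)))) =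
          pochhammer (b - 1/2) k / (fact k * pochhammer b k * pochhammer (2 * b - 1) k) * z ^ k"
      unfolding sum_inverse_pochhammer_product[OF assms] by (simp add: power_divide)
  qed
  finally show ?thesis ..
qed

section \<open>The terminating very well-poised sum\<close>

text \<open>
  \<open>(p - 1)\<^sub>n ((p + 1)/2)\<^sub>n / (n! ((p - 1)/2)\<^sub>n)\<close>, with the factor \<open>p - 1\<close> cancelled so that \<open>p = 1\<close> is allowed.
\<close>

fun neumann_coeff :: "real \<Rightarrow> nat \<Rightarrow> real" where
  "neumann_coeff p 0 = 1"
| "neumann_coeff p (Suc n) = (p + 2 * n + 1) * pochhammer p n / fact (Suc n)"

text \<open>This is what remains of the induction step for the telescoping sum below once the common
  hypergeometric factor is divided out. Over the common denominator it is a polynomial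
  identity.\<close>

lemma well_poised_certificate:
  fixes q c m n :: real
  assumes "n + 1 \<noteq> 0" "c + n \<noteq> 0" "2 * q + m + 1 + n \<noteq> 0"
  shows "n + q - (c + m) * (q + m) * (2 * q + 2 * n + 1) * (m + 1) / ((n + 1) * (c + n) * (2 * q + m + 1 + n))
           - (c - q + m) * (2 * q + 2 * n + 1) * (n - m) / ((n + 1) * (c + n)) =
         (n + 1 + q) * (2 * q + n) * (2 * q - c + n + 1) * (n - m) / ((n + 1) * (c + n) * (2 * q + m + 1 + n))"
proof -
  have *: "x - A / (v * s * u) - B / (v * s) = R / (v * s * u)"
    if "x * v * s * u - A - B * u = R" "v \<noteq> 0" "s \<noteq> 0" "u \<noteq> 0" for x A v s u B R :: real
    using that by (simp add: divide_simps)
  show ?thesis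
  proof (rule *)
    show "(n + q) * (n + 1) * (c + n) * (2 * q + m + 1 + n) -
            (c + m) * (q + m) * (2 * q + 2 * n + 1) * (m + 1) -
            (c - q + m) * (2 * q + 2 * n + 1) * (n - m) * (2 * q + m + 1 + n) =
          (n + 1 + q) * (2 * q + n) * (2 * q - c + n + 1) * (n - m)"
      by (simp add: algebra_simps)
  qed (use assms in auto)
qed

text \<open>
  A Wilf-Zeilberger certificate: the recurrence in \<open>m\<close> that is expected for the sum of \<open>T m n\<close> over \<open>n\<close>
  telescopes in \<open>n\<close>.
\<close>

lemma well_poised_partial_sum:
  fixes q c :: real
  assumes q: "q > 0" and c: "c > 0"
  defines "T \<equiv> (\<lambda>m n. neumann_coeff (2 * q) n * pochhammer (2 * q - c) n / pochhammer c n *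
                      pochhammer (- real m) n / pochhammer (2 * q + m) n)"
  shows "(\<Sum>n\<le>N. (c + m) * (q + m) * T (Suc m) n - (c - q + m) * (2 * q + m) * T m n) =
           (N + q) * pochhammer (2 * q) N / fact N * pochhammer (2 * q - c) (Suc N) / pochhammer c N *
           pochhammer (- real m) N / pochhammer (2 * q + m + 1) N"
proof (induction N)
  case 0
  show ?case by (simp add: T_def algebra_simps)
next
  case (Suc N)
  define P where "P = pochhammer (2 * q) N"
  define C where "C = pochhammer (2 * q - c) (Suc N)"
  define E where "E = pochhammer c N"
  define M where "M = pochhammer (- real m) N"
  define Q where "Q = pochhammer (2 * q + m + 1) N"
  define F where "F = (fact N :: real)"
  \<comment> \<open>Every term of the induction step is \<open>K\<close> times a rational function
    of \<open>N\<close>, \<open>m\<close>, \<open>q\<close> and \<open>c\<close>.\<close>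
  define K where "K = P * C * M / (F * E * Q)"
  have nz: "c + N > 0" "2 * q + m + 1 + N > 0" "2 * q + m > 0" "real N + 1 > 0"
    using q c by (auto intro!: add_pos_nonneg)
  have M1: "pochhammer (- real (Suc m)) (Suc N) = - ((m + 1) * M)"
    by (simp add: pochhammer_rec M_def algebra_simps)
  have M2: "pochhammer (- real m) (Suc N) = M * (real N - real m)"
    by (simp add: pochhammer_Suc M_def)
  have Q1: "pochhammer (2 * q + real (Suc m)) (Suc N) = Q * (2 * q + m + 1 + N)"
    by (simp add: pochhammer_Suc Q_def add_ac)
  have Q1': "pochhammer (2 * q + real m + 1) (Suc N) = Q * (2 * q + m + 1 + N)"
    by (simp add: pochhammer_Suc Q_def add_ac)
  have Q2: "pochhammer (2 * q + real m) (Suc N) = (2 * q + m) * Q"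
    by (simp add: pochhammer_rec Q_def add_ac)
  have E1: "pochhammer c (Suc N) = E * (c + N)" by (simp add: pochhammer_Suc E_def)
  have C1: "pochhammer (2 * q - c) (Suc (Suc N)) = C * (2 * q - c + N + 1)"
    unfolding C_def by (subst pochhammer_Suc) simp
  have P1: "pochhammer (2 * q) (Suc N) = P * (2 * q + N)" by (simp add: pochhammer_Suc P_def)
  have F1: "fact (Suc N) = (real N + 1) * F" by (simp add: F_def)
  have "T (Suc m) (Suc N) = (2 * q + 2 * N + 1) * P / ((N + 1) * F) * C / (E * (c + N)) *
              (- ((m + 1) * M)) / (Q * (2 * q + m + 1 + N))"
    unfolding T_def neumann_coeff.simps M1 Q1 E1 F1 C_def P_def by simp
  also have "\<dots> = K * (- ((2 * q + 2 * N + 1) * (m + 1) / ((N + 1) * (c + N) * (2 * q + m + 1 + N))))"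
    by (simp add: K_def mult_ac)
  finally have T1: "T (Suc m) (Suc N) = \<dots>" .
  have "T m (Suc N) = (2 * q + 2 * N + 1) * P / ((N + 1) * F) * C / (E * (c + N)) *
              (M * (real N - real m)) / ((2 * q + m) * Q)"
    unfolding T_def neumann_coeff.simps M2 Q2 E1 F1 C_def P_def by simp
  also have "\<dots> = K * ((2 * q + 2 * N + 1) * (real N - real m) / ((N + 1) * (c + N))) / (2 * q + m)"
    by (simp add: K_def mult_ac)
  finally have T2: "(2 * q + m) * T m (Suc N) = K * ((2 * q + 2 * N + 1) * (real N - real m) / ((N + 1) * (c + N)))"
    using nz by simp
  have "(N + q) * P / F * C / E * M / Q +
          ((c + m) * (q + m) * T (Suc m) (Suc N) - (c - q + m) * (2 * q + m) * T m (Suc N)) =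
        K * (N + q) + ((c + m) * (q + m) * T (Suc m) (Suc N) - (c - q + m) * ((2 * q + m) * T m (Suc N)))"
    by (simp add: K_def mult_ac)
  also have "\<dots> = K * (N + q - (c + m) * (q + m) * (2 * q + 2 * N + 1) * (m + 1) / ((N + 1) * (c + N) * (2 * q + m + 1 + N))
           - (c - q + m) * (2 * q + 2 * N + 1) * (real N - real m) / ((N + 1) * (c + N)))"
    unfolding T1 T2 right_diff_distrib[of K] by (simp add: mult_ac)
  also have "\<dots> = K * ((N + 1 + q) * (2 * q + N) * (2 * q - c + N + 1) * (real N - real m) /
                         ((N + 1) * (c + N) * (2 * q + m + 1 + N)))"
    using well_poised_certificate[OF nz(4,1,2)[THEN less_imp_neq, symmetric]]
    by (simp only: of_nat_add of_nat_1 of_nat_mult of_nat_numeral)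
  also have "\<dots> = (N + 1 + q) * (P * (2 * q + N)) / ((N + 1) * F) * (C * (2 * q - c + N + 1))
                / (E * (c + N)) * (M * (real N - real m)) / (Q * (2 * q + m + 1 + N))"
    by (simp only: K_def times_divide_eq_right times_divide_eq_left divide_divide_eq_left mult_ac)
  finally show ?case
    unfolding sum.atMost_Suc Suc.IH M2 Q1' E1 C1 P1 F1
    unfolding P_def C_def E_def M_def Q_def F_def
    by (simp only: Suc_eq_plus1 of_nat_add of_nat_1)
qed

text \<open>At N = m + 1 the telescoped right-hand side contains (-m)_(m+1) = 0, so the recurrence
  in m holds without remainder. Being of first order, it determines the sum from its value 1 at m =
  0.\<close>

lemma well_poised_sum:
  fixes q c :: real
  assumes q: "q > 0" and c: "c > 0"
  shows "(\<Sum>n\<le>m. neumann_coeff (2 * q) n * pochhammer (2 * q - c) n / pochhammer c n *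
                   pochhammer (- real m) n / pochhammer (2 * q + m) n) =
           pochhammer (c - q) m * pochhammer (2 * q) m / (pochhammer c m * pochhammer q m)"
proof (induction m)
  case (Suc m)
  define T where "T = (\<lambda>m n. neumann_coeff (2 * q) n * pochhammer (2 * q - c) n / pochhammer c n *
                      pochhammer (- real m) n / pochhammer (2 * q + m) n)"
  have zero: "pochhammer (- real m) (Suc m) = 0"
    by (rule pochhammer_of_nat_eq_0_lemma) simp
  have "(\<Sum>n\<le>Suc m. (c + m) * (q + m) * T (Suc m) n - (c - q + m) * (2 * q + m) * T m n) = 0"
    unfolding T_def using well_poised_partial_sum[OF q c, of m "Suc m"] zero by simp
  hence "(c + m) * (q + m) * (\<Sum>n\<le>Suc m. T (Suc m) n) = (c - q + m) * (2 * q + m) * (\<Sum>n\<le>Suc m. T m n)"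
    unfolding sum_subtractf sum_distrib_left [symmetric] by simp
  \<comment> \<open>The recurrence sums \<open>T m\<close> one index beyond \<open>m\<close>; the
    extra term carries the vanishing factor (-m)_(m+1).\<close>
  also have "(\<Sum>n\<le>Suc m. T m n) = (\<Sum>n\<le>m. T m n)"
    using zero by (simp add: T_def)
  finally have "(\<Sum>n\<le>Suc m. T (Suc m) n) =
      (c - q + m) * (2 * q + m) * (\<Sum>n\<le>m. T m n) / ((c + m) * (q + m))"
  proof -
    have *: "x = R / (u * v)" if "u * v * x = R" "u \<noteq> 0" "v \<noteq> 0" for x R u v :: real
      using that by (auto simp: field_simps)
    assume "(c + m) * (q + m) * (\<Sum>n\<le>Suc m. T (Suc m) n) = (c - q + m) * (2 * q + m) * (\<Sum>n\<le>m. T m n)"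
    thus ?thesis by (rule *) (use q c in auto)
  qed
  also have "(\<Sum>n\<le>m. T m n) = pochhammer (c - q) m * pochhammer (2 * q) m / (pochhammer c m * pochhammer q m)"
    using Suc by (simp add: T_def)
  also have "(c - q + m) * (2 * q + m) * \<dots> / ((c + m) * (q + m)) =
      pochhammer (c - q) (Suc m) * pochhammer (2 * q) (Suc m) / (pochhammer c (Suc m) * pochhammer q (Suc m))"
    unfolding pochhammer_Suc by (simp add: mult_ac)
  finally show ?case unfolding T_def .
qed simp

section \<open>Differential relations and a zero of the Bessel series\<close>

lemma has_real_derivative_hyp0F1:
  fixes b z :: real
  assumes "b > 0"
  shows "(hyp0F1 b has_real_derivative hyp0F1 (b + 1) z / b) (at z)"
proof -
  define c where "c = (\<lambda>k. 1 / (fact k * pochhammer b k))"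
  have eq: "hyp0F1 b = (\<lambda>z. \<Sum>k. c k * z ^ k)"
    by (simp add: fun_eq_iff hyp0F1_def c_def)
  have "((\<lambda>z. \<Sum>k. c k * z ^ k) has_real_derivative (\<Sum>k. diffs c k * z ^ k)) (at z)"
    by (rule termdiffs_strong_converges_everywhere)
       (use summable_hyp0F1[OF assms] in \<open>simp add: c_def\<close>)
  also have "(\<Sum>k. diffs c k * z ^ k) = (\<Sum>k. z ^ k / (fact k * pochhammer (b + 1) k) / b)"
    by (rule suminf_cong) (simp add: c_def diffs_def pochhammer_rec mult_ac del: of_nat_Suc)
  also have "\<dots> = hyp0F1 (b + 1) z / b"
    unfolding hyp0F1_def using assms by (intro suminf_divide summable_hyp0F1) simp
  finally show ?thesis unfolding eq .
qed

text \<open>Three-term recurrence of Bessel functions in normalised form. The constant terms cancel,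
  and 1 / (b)_(k+1) - 1 / (b+1)_(k+1) has numerator k + 1 over b (b+1) (b+2)_k, which reduces (k+1)!
  to k! and shifts the series by one.\<close>

lemma hyp0F1_contiguous:
  fixes b z :: real
  assumes "b > 0"
  shows "hyp0F1 b z - hyp0F1 (b + 1) z = z / (b * (b + 1)) * hyp0F1 (b + 2) z"
proof -
  define f where "f = (\<lambda>k. z ^ k / (fact k * pochhammer b k) - z ^ k / (fact k * pochhammer (b + 1) k))"
  have sm: "summable f"
    unfolding f_def using assms by (intro summable_diff summable_hyp0F1) auto
  have f_Suc: "f (Suc k) = z / (b * (b + 1)) * (z ^ k / (fact k * pochhammer (b + 2) k))" for k
  proof -
    define P where "P = pochhammer (b + 2) k"
    have pos: "P > 0" "b + k + 1 > 0" using assms by (auto simp: P_def intro!: pochhammer_pos)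
    have 1: "pochhammer b (Suc k) = b * (b + 1) * P / (b + k + 1)"
    proof -
      have "pochhammer b (Suc (Suc k)) = b * (b + 1) * P"
        by (simp only: pochhammer_rec P_def) (simp add: add_ac)
      moreover have "pochhammer b (Suc (Suc k)) = pochhammer b (Suc k) * (b + k + 1)"
        by (subst pochhammer_Suc) (simp add: add_ac)
      ultimately show ?thesis using pos by (simp add: field_simps)
    qed
    have 2: "pochhammer (b + 1) (Suc k) = (b + 1) * P"
      by (simp add: pochhammer_rec P_def add_ac)
    show ?thesis
      unfolding f_def 1 2 P_def[symmetric] using pos assms
      by (simp add: divide_simps) (simp add: algebra_simps)
  qed
  have "hyp0F1 b z - hyp0F1 (b + 1) z = suminf f"
    unfolding hyp0F1_def f_def using assms by (intro suminf_diff summable_hyp0F1) auto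
  also have "\<dots> = (\<Sum>k. f (Suc k))"
    using suminf_split_head[OF sm] by (simp add: f_def)
  also have "\<dots> = z / (b * (b + 1)) * hyp0F1 (b + 2) z"
    unfolding f_Suc hyp0F1_def using assms by (intro suminf_mult summable_hyp0F1) simp
  finally show ?thesis .
qed

text \<open>Without a zero, the logarithmic derivative would exist on the whole half-line, and the
  arctangent of its negative would gain at least pi over an interval of length 2 pi. But arctan
  stays strictly between -pi/2 and pi/2.\<close>

lemma hyp0F1_has_zero:
  fixes b :: real
  assumes b: "b > 0"
  shows "\<exists>x>0. hyp0F1 b (- (x ^ 2) / 4) = 0"
proof (rule ccontr)
  assume "\<not> ?thesis"
  hence nz: "hyp0F1 b (- (x ^ 2) / 4) \<noteq> 0" if "x > 0" for x using that by blast
  define u where "u = (\<lambda>x::real. hyp0F1 b (- (x ^ 2) / 4))"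
  define v where "v = (\<lambda>x::real. hyp0F1 (b + 1) (- (x ^ 2) / 4))"
  \<comment> \<open>\<open>R = -u'/u\<close> solves a Riccati equation that forces \<open>arctan R\<close> to grow at least at rate \<open>1/2\<close>.\<close>
  define R where "R = (\<lambda>x. x * v x / (2 * b * u x))"
  have inner: "((\<lambda>x. - (x ^ 2) / 4) has_real_derivative - x / 2) (at x)" for x :: real
    by (auto intro!: derivative_eq_intros)
  have u': "(u has_real_derivative - x * v x / (2 * b)) (at x)" for x
  proof -
    have "(u has_real_derivative v x / b * (- x / 2)) (at x)"
      unfolding u_def v_def by (rule DERIV_chain2[OF has_real_derivative_hyp0F1[OF b] inner])
    thus ?thesis by (simp add: mult.commute)
  qed
  \<comment> \<open>The contiguous relation eliminates the series with parameter
    \<open>b + 2\<close>, so \<open>u\<close> and \<open>v\<close> satisfy a closed first-order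
    system.\<close>
  have v': "(v has_real_derivative 2 * b * (u x - v x) / x) (at x)" if "x > 0" for x
  proof -
    have "(v has_real_derivative hyp0F1 (b + 1 + 1) (- (x ^ 2) / 4) / (b + 1) * (- x / 2)) (at x)"
      unfolding v_def by (rule DERIV_chain2[OF has_real_derivative_hyp0F1 inner]) (use b in auto)
    moreover have "hyp0F1 (b + 1 + 1) (- (x ^ 2) / 4) / (b + 1) * (- x / 2) = 2 * b * (u x - v x) / x"
    proof -
      have "b + 1 + 1 = b + 2" by simp
      thus ?thesis unfolding u_def v_def hyp0F1_contiguous[OF b] using b that
        by (simp only:) (simp add: divide_simps power2_eq_square)
    qed
    ultimately show ?thesis by simp
  qed
  have R': "(R has_real_derivative 1 + R x ^ 2 - (2 * b - 1) * R x / x) (at x)" if x: "x > 0" for x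
  proof -
    have ux: "u x \<noteq> 0" using nz[OF x] by (simp add: u_def)
    show ?thesis unfolding R_def
      by (rule derivative_eq_intros u' v'[OF x] refl)+
         (use ux b x in \<open>auto simp: field_simps power2_eq_square\<close>)
  qed
  \<comment> \<open>Beyond \<open>X\<close>, the linear term of the Riccati equation is at most |R|
    \<le> (1 + R^2)/2 in absolute value; the added 1 keeps \<open>X\<close> positive. Rate 1/2 over
    length 2 pi yields the required pi.\<close>
  define X where "X = \<bar>2 * b - 1\<bar> + 1"
  have "\<exists>z. z > X \<and> z < X + 2 * pi \<and>
          arctan (R (X + 2 * pi)) - arctan (R X) =
          (X + 2 * pi - X) * ((1 + R z ^ 2 - (2 * b - 1) * R z / z) / (1 + R z ^ 2))"
  proof (rule MVT2)
    fix x assume "X \<le> x" "x \<le> X + 2 * pi"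
    hence "x > 0" by (simp add: X_def)
    from R'[OF this] show "((\<lambda>x. arctan (R x)) has_real_derivative
         (1 + R x ^ 2 - (2 * b - 1) * R x / x) / (1 + R x ^ 2)) (at x)"
      by (auto intro!: derivative_eq_intros simp: divide_inverse mult.commute)
  qed simp
  then obtain z where z: "z > X" and
    eq: "arctan (R (X + 2 * pi)) - arctan (R X) =
          2 * pi * ((1 + R z ^ 2 - (2 * b - 1) * R z / z) / (1 + R z ^ 2))"
    by auto
  have "1 / 2 \<le> (1 + R z ^ 2 - (2 * b - 1) * R z / z) / (1 + R z ^ 2)"
  proof -
    have z0: "z > 0" "\<bar>2 * b - 1\<bar> \<le> z" using z by (auto simp: X_def)
    have "\<bar>(2 * b - 1) * R z / z\<bar> = \<bar>2 * b - 1\<bar> / z * \<bar>R z\<bar>" using z0 by (simp add: abs_mult)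
    also have "\<dots> \<le> 1 * \<bar>R z\<bar>" using z0 by (intro mult_right_mono) auto
    also have "\<dots> \<le> (1 + R z ^ 2) / 2"
      using zero_le_power2[of "\<bar>R z\<bar> - 1"] by (simp add: power2_diff)
    finally have "(1 + R z ^ 2) / 2 \<le> 1 + R z ^ 2 - (2 * b - 1) * R z / z"
    proof -
      have "(1 + s) / 2 \<le> 1 + s - y" if "\<bar>y\<bar> \<le> (1 + s) / 2" for y s :: real
        using that by (simp add: abs_le_iff field_simps)
      thus "\<bar>(2 * b - 1) * R z / z\<bar> \<le> (1 + R z ^ 2) / 2 \<Longrightarrow> ?thesis" .
    qed
    moreover have "1 + R z ^ 2 > 0" by (simp add: add_pos_nonneg)
    ultimately show ?thesis by (simp add: pos_le_divide_eq)
  qed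
  hence "pi \<le> arctan (R (X + 2 * pi)) - arctan (R X)"
    unfolding eq using mult_left_mono[of "1/2" _ "2 * pi"] by fastforce
  with arctan_ubound[of "R (X + 2 * pi)"] arctan_lbound[of "R X"] show False by linarith
qed

section \<open>Euler's Beta integral\<close>

text \<open>These are the moments of the Beta weight: inserting t^k contributes (c)_k / (c+r)_k,
  exactly the factor that turns the lower parameter c of a series coefficient into c + r.\<close>

lemma Beta_plus_nat_left:
  fixes c r :: real
  assumes "c > 0" "r > 0"
  shows "Beta (c + real k) r = Beta c r * pochhammer c k / pochhammer (c + r) k"
proof (induction k)
  case (Suc k)
  have "c + real k \<notin> \<int>\<^sub>\<le>\<^sub>0" using assms by (auto dest: nonpos_Ints_nonpos)
  from Beta_plus1_left[OF this, of r]
  have "Beta (c + real (Suc k)) r = (c + k) / (c + r + k) * Beta (c + k) r"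
    using assms by (simp add: field_simps)
  thus ?case unfolding Suc.IH by (simp add: pochhammer_Suc mult_ac)
qed simp

text \<open>Termwise integration by dominated convergence: for t in [0,1] every partial sum is
  bounded by the sum of the absolute values at t = 1, so a constant multiple of the integrable
  weight is a majorant.\<close>

lemma hyp1F2_Beta_integral:
  fixes a b c r z :: real
  assumes "a > 0" "b > 0" "c > 0" "r > 0"
  shows "((\<lambda>t. t powr (c - 1) * (1 - t) powr (r - 1) * hyp1F2 a b c (z * t)) has_integral
           Beta c r * hyp1F2 a b (c + r) z) {0..1}"
proof -
  define \<alpha> where "\<alpha> = (\<lambda>k. pochhammer a k / (fact k * pochhammer b k * pochhammer c k))"
  define \<omega> where "\<omega> = (\<lambda>t. t powr (c - 1) * (1 - t) powr (r - 1))"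
  have \<omega>_nonneg: "\<omega> t \<ge> 0" for t by (simp add: \<omega>_def)
  have \<omega>_int: "(\<omega> has_integral Beta c r) {0..1}"
    unfolding \<omega>_def using assms by (intro has_integral_Beta_real) auto
  have pow: "((\<lambda>t. \<omega> t * t ^ k) has_integral Beta (c + real k) r) {0..1}" for k
  proof -
    have "((\<lambda>t. t powr (c + real k - 1) * (1 - t) powr (r - 1)) has_integral Beta (c + real k) r) {0..1}"
      using assms by (intro has_integral_Beta_real) auto
    moreover have "t powr (c + real k - 1) * (1 - t) powr (r - 1) = \<omega> t * t ^ k" if "t \<in> {0..1}" for t
    \<comment> \<open>Since \<open>0 powr y\<close> is 0 for every y, both sides vanish at t = 0,
      even when k = 0.\<close>
    proof (cases "t = 0")
      case False
      hence "t powr (c + real k - 1) = t powr (c - 1) * t ^ k"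
        using that by (simp add: powr_realpow[symmetric] powr_add[symmetric] algebra_simps)
      thus ?thesis by (simp add: \<omega>_def)
    qed (simp add: \<omega>_def)
    ultimately show ?thesis by (rule has_integral_eq[rotated])
  qed
  have sm: "summable (\<lambda>k. \<bar>\<alpha> k * z ^ k\<bar>)"
    unfolding \<alpha>_def using assms by (intro abs_summable_hyp1F2)
  have "((\<lambda>t. \<omega> t * hyp1F2 a b c (z * t)) has_integral Beta c r * hyp1F2 a b (c + r) z) {0..1}"
  proof (rule has_integral_dominated_convergence)
    fix N :: nat
    have "((\<lambda>t. \<Sum>k<N. \<alpha> k * z ^ k * (\<omega> t * t ^ k)) has_integral
             (\<Sum>k<N. \<alpha> k * z ^ k * Beta (c + real k) r)) {0..1}"
      by (intro has_integral_sum has_integral_mult_right pow) auto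
    thus "((\<lambda>t. \<omega> t * (\<Sum>k<N. \<alpha> k * (z * t) ^ k)) has_integral
             (\<Sum>k<N. \<alpha> k * z ^ k * Beta (c + real k) r)) {0..1}"
      by (simp add: sum_distrib_left power_mult_distrib mult_ac)
  next
    show "(\<lambda>t. \<omega> t * (\<Sum>k. \<bar>\<alpha> k * z ^ k\<bar>)) integrable_on {0..1}"
      using \<omega>_int by (intro integrable_on_mult_left) auto
  next
    fix N
    show "\<forall>t\<in>{0..1}. norm (\<omega> t * (\<Sum>k<N. \<alpha> k * (z * t) ^ k)) \<le> \<omega> t * (\<Sum>k. \<bar>\<alpha> k * z ^ k\<bar>)"
    proof
      fix t :: real assume t: "t \<in> {0..1}"
      have "\<bar>\<Sum>k<N. \<alpha> k * (z * t) ^ k\<bar> \<le> (\<Sum>k<N. \<bar>\<alpha> k * (z * t) ^ k\<bar>)" by (rule sum_abs)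
      also have "\<dots> \<le> (\<Sum>k<N. \<bar>\<alpha> k * z ^ k\<bar>)"
      proof (rule sum_mono)
        fix k
        have "\<bar>\<alpha> k * z ^ k\<bar> * t ^ k \<le> \<bar>\<alpha> k * z ^ k\<bar> * 1"
          using t by (intro mult_left_mono power_le_one) auto
        thus "\<bar>\<alpha> k * (z * t) ^ k\<bar> \<le> \<bar>\<alpha> k * z ^ k\<bar>"
          using t by (simp add: power_mult_distrib abs_mult mult_ac)
      qed
      also have "\<dots> \<le> (\<Sum>k. \<bar>\<alpha> k * z ^ k\<bar>)" by (rule sum_le_suminf[OF sm]) auto
      finally show "norm (\<omega> t * (\<Sum>k<N. \<alpha> k * (z * t) ^ k)) \<le> \<omega> t * (\<Sum>k. \<bar>\<alpha> k * z ^ k\<bar>)"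
        using \<omega>_nonneg[of t] by (simp add: abs_mult mult_left_mono)
    qed
  next
    show "\<forall>t\<in>{0..1}. (\<lambda>N. \<omega> t * (\<Sum>k<N. \<alpha> k * (z * t) ^ k)) \<longlonglongrightarrow> \<omega> t * hyp1F2 a b c (z * t)"
      unfolding hyp1F2_def \<alpha>_def using assms
      by (intro ballI tendsto_mult_left summable_LIMSEQ summable_hyp1F2)
  next
    have "(\<lambda>k. Beta c r * (pochhammer a k / (fact k * pochhammer b k * pochhammer (c + r) k) * z ^ k)) sums
            (Beta c r * hyp1F2 a b (c + r) z)"
      unfolding hyp1F2_def using assms by (intro sums_mult summable_sums summable_hyp1F2) auto
    also have "(\<lambda>k. Beta c r * (pochhammer a k / (fact k * pochhammer b k * pochhammer (c + r) k) * z ^ k)) =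
               (\<lambda>k. \<alpha> k * z ^ k * Beta (c + real k) r)"
    proof
      fix k
      have "pochhammer c k > 0" using assms by (intro pochhammer_pos)
      thus "Beta c r * (pochhammer a k / (fact k * pochhammer b k * pochhammer (c + r) k) * z ^ k) =
            \<alpha> k * z ^ k * Beta (c + real k) r"
        unfolding Beta_plus_nat_left[OF assms(3,4)] \<alpha>_def by simp
    qed
    finally show "(\<lambda>N. \<Sum>k<N. \<alpha> k * z ^ k * Beta (c + real k) r) \<longlonglongrightarrow> Beta c r * hyp1F2 a b (c + r) z"
      by (simp add: sums_def)
  qed
  thus ?thesis by (simp add: \<omega>_def)
qed

lemma isCont_hyp1F2:
  fixes a b c z :: real
  assumes "a > 0" "b > 0" "c > 0"
  shows "isCont (hyp1F2 a b c) z"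
  unfolding hyp1F2_def
  by (rule isCont_powser_converges_everywhere) (rule summable_hyp1F2[OF assms])

lemma hyp1F2_at_0 [simp]: "hyp1F2 a b c 0 = 1"
  unfolding hyp1F2_def powser_zero by simp

lemma hyp1F2_commute: "hyp1F2 a b c = hyp1F2 a c b"
  by (simp add: hyp1F2_def fun_eq_iff mult_ac)

text \<open>By compactness the function being averaged has a positive minimum on [0,1] (its value at
  t = 0 is 1), and the Beta integral is at least this minimum times the positive mass of the
  weight.\<close>

lemma hyp1F2_pos_increase_lower:
  fixes a b c r z :: real
  assumes "a > 0" "b > 0" "c > 0" "r \<ge> 0"
    and pos: "\<And>z. z < 0 \<Longrightarrow> hyp1F2 a b c z > 0" and "z < 0"
  shows "hyp1F2 a b (c + r) z > 0"
proof (cases "r = 0")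
  case False
  with assms have r: "r > 0" by simp
  have "continuous_on {0..1} (\<lambda>t. hyp1F2 a b c (z * t))"
    by (intro continuous_at_imp_continuous_on ballI
          isCont_o2[where g = "hyp1F2 a b c", OF _ isCont_hyp1F2[OF assms(1-3)]] continuous_intros)
  then obtain s where s: "s \<in> {0..1}" "\<And>t. t \<in> {0..1} \<Longrightarrow> hyp1F2 a b c (z * s) \<le> hyp1F2 a b c (z * t)"
    using continuous_attains_inf[of "{0..1::real}" "\<lambda>t. hyp1F2 a b c (z * t)"] by auto
  have m: "hyp1F2 a b c (z * s) > 0"
    using pos[of "z * s"] s(1) \<open>z < 0\<close> by (cases "s = 0") (auto simp: mult_less_0_iff)
  have B: "Beta c r > 0" using assms r by (simp add: Beta_def Gamma_real_pos)
  have "Beta c r * hyp1F2 a b c (z * s) \<le> Beta c r * hyp1F2 a b (c + r) z"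
  proof (rule has_integral_le)
    show "((\<lambda>t. t powr (c - 1) * (1 - t) powr (r - 1) * hyp1F2 a b c (z * s)) has_integral
             Beta c r * hyp1F2 a b c (z * s)) {0..1}"
      using assms r by (intro has_integral_mult_left has_integral_Beta_real)
    show "((\<lambda>t. t powr (c - 1) * (1 - t) powr (r - 1) * hyp1F2 a b c (z * t)) has_integral
             Beta c r * hyp1F2 a b (c + r) z) {0..1}"
      by (rule hyp1F2_Beta_integral[OF assms(1-3) r])
  qed (use s(2) in \<open>auto intro!: mult_left_mono\<close>)
  with B m show ?thesis by (simp add: mult_le_cancel_left_pos)
qed (use assms in simp)

section \<open>Gasper's expansion in squares\<close>

text \<open>The product majorant makes the family absolutely summable over all pairs, so summation
  by rows and along the diagonals n + k = m gives the same value.\<close>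

lemma double_series_diagonal_sums:
  fixes u :: "nat \<Rightarrow> nat \<Rightarrow> real"
  assumes bound: "\<And>n k. \<bar>u n k\<bar> \<le> A n * B k"
    and A: "summable A" "\<And>n. A n \<ge> 0" and B: "summable B" "\<And>k. B k \<ge> 0"
    and rows: "\<And>n. u n sums r n"
    and diag: "(\<lambda>m. \<Sum>n\<le>m. u n (m - n)) sums S"
  shows "r sums S"
proof -
  have "(\<lambda>(n, k). A n * B k) summable_on UNIV \<times> UNIV"
  proof (rule summable_on_SigmaI)
    show "((\<lambda>k. case (n, k) of (n, k) \<Rightarrow> A n * B k) has_sum A n * suminf B) UNIV" for n
      using sums_nonneg_imp_has_sum[OF summable_sums[OF B(1)] B(2)]
      by (simp add: has_sum_cmult_right)
    show "(\<lambda>n. A n * suminf B) summable_on UNIV"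
      using A by (intro summable_on_cmult_left summable_nonneg_imp_summable_on)
  qed (use A B in auto)
  hence "(\<lambda>x. norm (case x of (n, k) \<Rightarrow> u n k)) summable_on UNIV \<times> UNIV"
    by (rule Infinite_Sum.abs_summable_on_comparison_test') (use bound in auto)
  hence "(\<lambda>(n, k). u n k) summable_on UNIV \<times> UNIV"
    by (rule abs_summable_summable)
  then obtain S' where S': "((\<lambda>(n, k). u n k) has_sum S') (UNIV \<times> UNIV)"
    by (auto simp: summable_on_def)
  have "summable (\<lambda>k. norm (u n k))" for n
    by (rule summable_comparison_test'[OF summable_mult[OF B(1), of "A n"]]) (use bound in auto)
  hence "(u n has_sum r n) UNIV" for n
    using rows by (rule norm_summable_imp_has_sum)
  hence "(r has_sum S') UNIV"
    by (intro has_sum_SigmaD[OF S']) auto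
  hence r: "r sums S'" by (rule has_sum_imp_sums)
  have "((\<lambda>(m, n). u n (m - n)) has_sum S') (SIGMA m:UNIV. {..m})"
    using S' by (subst has_sum_reindex_bij_witness
        [where S = "SIGMA m:UNIV. {..m}" and T = "UNIV \<times> UNIV" and h = "\<lambda>(n, k). u n k"
           and j = "\<lambda>(m, n). (n, m - n)" and i = "\<lambda>(n, k). (n + k, n)"]) auto
  hence "((\<lambda>m. \<Sum>n\<le>m. u n (m - n)) has_sum S') UNIV"
    by (rule has_sum_SigmaD) (auto intro!: has_sum_finiteI)
  hence "(\<lambda>m. \<Sum>n\<le>m. u n (m - n)) sums S'" by (rule has_sum_imp_sums)
  with diag have "S' = S" by (rule sums_unique2[rotated])
  with r show ?thesis by simp
qed

lemma neumann_coeff_pos: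
  assumes "p > 0"
  shows "neumann_coeff p n > 0"
proof (cases n)
  case (Suc k)
  have "pochhammer p k > 0" "p + 2 * k + 1 > 0"
    using assms by (auto intro!: pochhammer_pos add_pos_nonneg)
  thus ?thesis unfolding Suc neumann_coeff.simps by (intro divide_pos_pos mult_pos_pos fact_gt_zero)
qed simp

lemma neumann_coeff_le:
  assumes "p > 0"
  shows "neumann_coeff p n \<le> 2 * (p + 1) ^ n"
proof (cases n)
  case (Suc k)
  have e: "pochhammer p j / fact j \<le> (p + 1) ^ j" for j
    using pochhammer_le_power_mult[of p 1 "p + 1" j] assms
    by (simp add: pochhammer_fact[symmetric] divide_le_eq)
  \<comment> \<open>Splits p + 2k + 1 as (p + k) + (k + 1).\<close>
  have "neumann_coeff p n = pochhammer p (Suc k) / fact (Suc k) + pochhammer p k / fact k"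
    unfolding Suc by (simp add: pochhammer_Suc divide_simps) (simp add: algebra_simps)
  also have "\<dots> \<le> (p + 1) ^ Suc k + (p + 1) ^ k"
    by (intro add_mono e)
  also have "(p + 1) ^ k \<le> (p + 1) ^ Suc k"
    using assms by (intro power_increasing) auto
  finally show ?thesis by (simp add: Suc)
qed simp

text \<open>The g_n of the overview; below, \<open>w\<close> stands for x^2/4, so that (x/2)^(2n)
  becomes \<open>w ^ n\<close>.\<close>

definition gasper_coeff :: "real \<Rightarrow> real \<Rightarrow> nat \<Rightarrow> real" where
  "gasper_coeff a b n = neumann_coeff (2 * b - 1) n * pochhammer (b - a - 1/2) n /
     (pochhammer (a + b - 1/2) n * 4 ^ n * pochhammer b n ^ 2)"

text \<open>Comparison of the coefficients of w^m. Factors depending only on m are collected in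
  \<open>K\<close>; the rest is the summand of \<open>well_poised_sum\<close>.\<close>

lemma gasper_diagonal_sum:
  fixes a b w :: real
  assumes a: "a > 0" and b: "b > 1/2"
  shows "(\<Sum>n\<le>m. gasper_coeff a b n * w ^ n * (pochhammer (b + n - 1/2) (m - n) /
            (fact (m - n) * pochhammer (b + n) (m - n) * pochhammer (2 * (b + n) - 1) (m - n)) * (- w) ^ (m - n))) =
         pochhammer a m / (fact m * pochhammer b m * pochhammer (a + b - 1/2) m) * (- w) ^ m"
proof -
  \<comment> \<open>With these choices 2q = 2b - 1, 2q - c = b - a - 1/2 and c - q = a, so the
    closed form produces (a)_m.\<close>
  define q where "q = b - 1/2"
  define c where "c = a + b - 1/2"
  have q: "q > 0" and c: "c > 0" using a b by (auto simp: q_def c_def)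
  define K where "K = (- w) ^ m * (pochhammer q m / (fact m * pochhammer b m * pochhammer (2 * q) m))"
  have "(\<Sum>n\<le>m. gasper_coeff a b n * w ^ n * (pochhammer (b + n - 1/2) (m - n) /
            (fact (m - n) * pochhammer (b + n) (m - n) * pochhammer (2 * (b + n) - 1) (m - n)) * (- w) ^ (m - n))) =
        (\<Sum>n\<le>m. K * (neumann_coeff (2 * q) n * pochhammer (2 * q - c) n / pochhammer c n *
                   pochhammer (- real m) n / pochhammer (2 * q + m) n))"
  proof (rule sum.cong[OF refl], goal_cases)
    case (1 n)
    hence n: "n \<le> m" by simp
    have pos: "pochhammer b n > 0" "pochhammer q n > 0" "pochhammer (2 * q) (2 * n) > 0"
         "pochhammer (2 * q) m > 0" "pochhammer (2 * q + m) n > 0" "pochhammer b m > 0"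
         "pochhammer (b + n) (m - n) > 0" "pochhammer (2 * q + 2 * n) (m - n) > 0"
      using b q by (auto intro!: pochhammer_pos)
    have q1: "pochhammer (b + n - 1/2) (m - n) = pochhammer q m / pochhammer q n"
    proof -
      have "pochhammer q m = pochhammer q n * pochhammer (b + n - 1/2) (m - n)"
        using pochhammer_product[OF n, of q] by (simp add: q_def algebra_simps)
      thus ?thesis using pos by simp
    qed
    have b1: "pochhammer (b + n) (m - n) = pochhammer b m / pochhammer b n"
      using pochhammer_product[OF n, of b] pos by simp
    \<comment> \<open>Splitting (2q)_(m+n) at 2n and at m expresses (2q + 2n)_(m-n) through symbols
      of length m and n.\<close>
    have "pochhammer (2 * q) (m + n) = pochhammer (2 * q) (2 * n) * pochhammer (2 * q + 2 * n) (m - n)"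
    proof -
      have "2 * n \<le> m + n" "m + n - 2 * n = m - n" using n by auto
      with pochhammer_product[of "2 * n" "m + n" "2 * q"] show ?thesis
        by (simp only: of_nat_mult of_nat_numeral)
    qed
    moreover have "pochhammer (2 * q) (m + n) = pochhammer (2 * q) m * pochhammer (2 * q + m) n"
      by (rule pochhammer_product')
    moreover have "pochhammer (2 * q) (2 * n) = 4 ^ n * pochhammer q n * pochhammer b n"
      using pochhammer_double[of q n] by (simp add: power_mult q_def)
    ultimately have p1: "pochhammer (2 * (b + n) - 1) (m - n) =
        pochhammer (2 * q) m * pochhammer (2 * q + m) n / (4 ^ n * pochhammer q n * pochhammer b n)"
    proof -
      assume "pochhammer (2 * q) (m + n) = pochhammer (2 * q) (2 * n) * pochhammer (2 * q + 2 * n) (m - n)"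
        "pochhammer (2 * q) (m + n) = pochhammer (2 * q) m * pochhammer (2 * q + m) n"
        "pochhammer (2 * q) (2 * n) = 4 ^ n * pochhammer q n * pochhammer b n"
      moreover have "2 * (b + n) - 1 = 2 * q + 2 * n" by (simp add: q_def)
      ultimately show ?thesis using pos by (simp only: nonzero_eq_divide_eq) simp
    qed
    have "fact m = fact (m - n) * pochhammer (real m - real n + 1) n"
      using pochhammer_product[of "m - n" m "1::real"] n
      by (simp add: pochhammer_fact[symmetric] of_nat_diff algebra_simps)
    hence f1: "pochhammer (- real m) n = (- 1) ^ n * (fact m / fact (m - n))"
      by (simp add: pochhammer_minus)
    have w1: "w ^ n * (- w) ^ (m - n) = (- 1) ^ n * (- w) ^ m"
    proof -
      have "(- w) ^ m = (- w) ^ n * (- w) ^ (m - n)" using n by (simp flip: power_add)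
      moreover have "w ^ n = (- 1) ^ n * (- w) ^ n" by (simp flip: power_mult_distrib)
      ultimately show ?thesis by simp
    qed
    have g: "gasper_coeff a b n = neumann_coeff (2 * q) n * pochhammer (2 * q - c) n /
       (pochhammer c n * 4 ^ n * pochhammer b n ^ 2)"
      unfolding gasper_coeff_def by (simp add: q_def c_def algebra_simps)
    have "gasper_coeff a b n * w ^ n * (pochhammer (b + n - 1/2) (m - n) /
            (fact (m - n) * pochhammer (b + n) (m - n) * pochhammer (2 * (b + n) - 1) (m - n)) * (- w) ^ (m - n)) =
          gasper_coeff a b n * (w ^ n * (- w) ^ (m - n)) * (pochhammer (b + n - 1/2) (m - n) /
            (fact (m - n) * pochhammer (b + n) (m - n) * pochhammer (2 * (b + n) - 1) (m - n)))"
      by (simp only: mult_ac)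
    also have "\<dots> = K * (neumann_coeff (2 * q) n * pochhammer (2 * q - c) n / pochhammer c n *
                   pochhammer (- real m) n / pochhammer (2 * q + m) n)"
      unfolding w1 q1 b1 p1 f1 g K_def using pos by (simp add: power2_eq_square) (simp only: mult_ac)
    finally show ?case .
  qed
  also have "\<dots> = K * (pochhammer (c - q) m * pochhammer (2 * q) m / (pochhammer c m * pochhammer q m))"
    unfolding sum_distrib_left[symmetric] well_poised_sum[OF q c] ..
  also have "\<dots> = pochhammer a m / (fact m * pochhammer b m * pochhammer c m) * (- w) ^ m"
    using pochhammer_pos[OF q, of m] pochhammer_pos[of "2 * q" m] q
    by (simp add: K_def c_def q_def) (simp only: mult_ac)
  finally show ?thesis unfolding c_def .
qed

text \<open>Since b > 1/2, |b - a - 1/2| is at most a + b - 1/2, whatever its sign, so that quotient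
  of Pochhammer symbols is at most 1. Also 4^n (b)_n^2 \<ge> (n!)^2 \<ge> n!.\<close>

lemma abs_gasper_coeff_le:
  fixes a b :: real
  assumes a: "a > 0" and b: "b > 1/2"
  shows "\<bar>gasper_coeff a b n\<bar> \<le> 2 * (2 * b) ^ n / fact n"
proof -
  have c: "pochhammer (a + b - 1/2) n > 0" using a b by (intro pochhammer_pos) auto
  have b': "pochhammer b n > 0" using b by (intro pochhammer_pos) auto
  have N: "neumann_coeff (2 * b - 1) n > 0" "neumann_coeff (2 * b - 1) n \<le> 2 * (2 * b) ^ n"
    using neumann_coeff_pos[of "2 * b - 1"] neumann_coeff_le[of "2 * b - 1"] b by auto
  have ratio: "\<bar>pochhammer (b - a - 1/2) n\<bar> / pochhammer (a + b - 1/2) n \<le> 1"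
    using abs_pochhammer_le[of "b - a - 1/2" "a + b - 1/2" n] a b c by (simp add: abs_if)
  have "fact n \<le> 2 ^ n * pochhammer b n"
    using pochhammer_le_power_mult[of 1 b 2 n] b by (simp add: pochhammer_fact)
  hence "(fact n :: real) ^ 2 \<le> (2 ^ n * pochhammer b n) ^ 2"
    by (intro power_mono) auto
  also have "\<dots> = 4 ^ n * pochhammer b n ^ 2"
    by (simp add: power_mult_distrib flip: power_mult) (simp add: power_mult mult.commute[of n])
  finally have f: "(fact n :: real) ^ 2 \<le> 4 ^ n * pochhammer b n ^ 2" .
  have "(fact n :: real) ^ 1 \<le> fact n ^ 2"
    by (intro power_increasing) auto
  with f have "(fact n :: real) \<le> 4 ^ n * pochhammer b n ^ 2" by (simp only: power_one_right)
  hence inv: "1 / (4 ^ n * pochhammer b n ^ 2) \<le> 1 / fact n"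
    using b' by (intro divide_left_mono) auto
  have "\<bar>gasper_coeff a b n\<bar> = neumann_coeff (2 * b - 1) n *
      (\<bar>pochhammer (b - a - 1/2) n\<bar> / pochhammer (a + b - 1/2) n) * (1 / (4 ^ n * pochhammer b n ^ 2))"
    unfolding gasper_coeff_def using N c b' by (simp add: abs_mult)
  also have "\<dots> \<le> 2 * (2 * b) ^ n * 1 * (1 / fact n)"
    using N ratio inv c b' b by (intro mult_mono) auto
  finally show ?thesis by simp
qed

text \<open>The rows of the double series are the squares expanded into powers of w; its diagonals
  are the terms of the \<open>hyp1F2\<close> series.\<close>

lemma hyp1F2_gasper_sums:
  fixes a b w :: real
  assumes a: "a > 0" and b: "b > 1/2"
  shows "(\<lambda>n. gasper_coeff a b n * w ^ n * hyp0F1 (b + n) (- w / 4) ^ 2) sums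
           hyp1F2 a b (a + b - 1/2) (- w)"
proof -
  define t where "t = (\<lambda>n k. pochhammer (b + real n - 1/2) k /
            (fact k * pochhammer (b + real n) k * pochhammer (2 * (b + real n) - 1) k) * (- w) ^ k)"
  have bn: "b + real n > 1/2" for n using b by simp
  show ?thesis
  proof (rule double_series_diagonal_sums)
    fix n
    have "t n sums hyp1F2 (b + real n - 1/2) (b + real n) (2 * (b + real n) - 1) (- w)"
      unfolding t_def hyp1F2_def using bn[of n] by (intro summable_sums summable_hyp1F2) auto
    also have "hyp1F2 (b + real n - 1/2) (b + real n) (2 * (b + real n) - 1) (- w) = hyp0F1 (b + n) (- w / 4) ^ 2"
      by (rule hyp1F2_eq_hyp0F1_square[OF bn])
    finally show "(\<lambda>k. gasper_coeff a b n * w ^ n * t n k) sums (gasper_coeff a b n * w ^ n * hyp0F1 (b + n) (- w / 4) ^ 2)"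
      by (rule sums_mult)
  next
    show "(\<lambda>m. \<Sum>n\<le>m. gasper_coeff a b n * w ^ n * t n (m - n)) sums hyp1F2 a b (a + b - 1/2) (- w)"
      unfolding t_def gasper_diagonal_sum[OF a b] hyp1F2_def
      using a b by (intro summable_sums summable_hyp1F2) auto
  next
    show "summable (\<lambda>n. 2 * ((2 * b * \<bar>w\<bar>) ^ n / fact n))"
      by (intro summable_mult summable_exp_real)
    show "summable (\<lambda>k. (2 * \<bar>w\<bar>) ^ k / fact k)" by (rule summable_exp_real)
  next
    \<comment> \<open>The bound on \<open>t n k\<close> has to be uniform in \<open>n\<close> for
      the majorant to factor; it is, because \<open>b + n\<close> stays above 1/2.\<close>
    fix n k
    have pos: "pochhammer (b + real n) k > 0" "pochhammer (2 * (b + real n) - 1) k > 0"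
              "pochhammer (b + real n - 1/2) k > 0"
      using b by (auto intro!: pochhammer_pos)
    have r1: "pochhammer (b + real n - 1/2) k / pochhammer (2 * (b + real n) - 1) k \<le> 1"
      using pochhammer_le_power_mult[of "b + real n - 1/2" "2 * (b + real n) - 1" 1 k] b pos by simp
    have "1 * (1/2) ^ k \<le> 2 ^ k * pochhammer (b + real n) k * (1/2) ^ k"
    proof (rule mult_right_mono)
      have "(1::real) \<le> fact k" by simp
      also have "\<dots> \<le> 2 ^ k * pochhammer (b + real n) k"
        using pochhammer_le_power_mult[of 1 "b + real n" 2 k] b by (simp add: pochhammer_fact)
      finally show "1 \<le> 2 ^ k * pochhammer (b + real n) k" .
    qed simp
    hence r2: "1 / pochhammer (b + real n) k \<le> 2 ^ k"
      using pos by (simp add: field_simps)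
    have "\<bar>t n k\<bar> = pochhammer (b + real n - 1/2) k / pochhammer (2 * (b + real n) - 1) k *
            (1 / pochhammer (b + real n) k) * (\<bar>w\<bar> ^ k / fact k)"
      unfolding t_def using pos by (simp add: abs_mult power_abs)
    also have "\<dots> \<le> 1 * 2 ^ k * (\<bar>w\<bar> ^ k / fact k)"
      using r1 r2 pos by (intro mult_mono) auto
    finally have t: "\<bar>t n k\<bar> \<le> (2 * \<bar>w\<bar>) ^ k / fact k" by (simp add: power_mult_distrib)
    have "\<bar>gasper_coeff a b n * w ^ n * t n k\<bar> = \<bar>gasper_coeff a b n\<bar> * \<bar>w\<bar> ^ n * \<bar>t n k\<bar>"
      by (simp add: abs_mult power_abs)
    also have "\<dots> \<le> (2 * (2 * b) ^ n / fact n) * \<bar>w\<bar> ^ n * ((2 * \<bar>w\<bar>) ^ k / fact k)"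
      using abs_gasper_coeff_le[OF a b] t b by (intro mult_mono) auto
    finally show "\<bar>gasper_coeff a b n * w ^ n * t n k\<bar> \<le>
        2 * ((2 * b * \<bar>w\<bar>) ^ n / fact n) * ((2 * \<bar>w\<bar>) ^ k / fact k)"
      by (simp add: power_mult_distrib mult_ac)
  qed (use b in auto)
qed

section \<open>Strict inequality and failure of positivity\<close>

text \<open>Strictness needs one square beyond the first that does not vanish at the given point.
  For a large parameter the series differs from its leading term 1 by at most exp(1/4) - 1 <
  1.\<close>

lemma hyp0F1_eventually_nonzero:
  fixes b z :: real
  assumes "b > 0"
  shows "\<exists>n. hyp0F1 (b + Suc n) z \<noteq> 0"
proof -
  obtain n where n: "\<bar>z\<bar> * 4 < real n" using reals_Archimedean2 by blast
  define \<beta> where "\<beta> = b + Suc n"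
  have \<beta>: "\<beta> > 0" "\<bar>z\<bar> / \<beta> \<le> 1/4" using n assms by (auto simp: \<beta>_def field_simps)
  define f where "f = (\<lambda>k. z ^ k / (fact k * pochhammer \<beta> k))"
  have sm: "summable f" "summable (\<lambda>k. norm (f k))"
    unfolding f_def using \<beta> by (auto intro: summable_hyp0F1 abs_summable_hyp0F1 simp del: real_norm_def)
  have sm': "summable (\<lambda>k. norm (f (Suc k)))"
    using sm(2) summable_Suc_iff[of "\<lambda>k. norm (f k)"] by blast
  have bound: "norm (f k) \<le> (1/4) ^ k / fact k" for k
  proof -
    have "norm (f k) \<le> (\<bar>z\<bar> / \<beta>) ^ k / fact k" unfolding f_def by (rule norm_hyp0F1_term_le[OF \<beta>(1)])
    also have "\<dots> \<le> (1/4) ^ k / fact k" using \<beta> by (intro divide_right_mono power_mono) auto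
    finally show ?thesis .
  qed
  have "\<bar>hyp0F1 \<beta> z - 1\<bar> = norm (\<Sum>k. f (Suc k))"
    using suminf_split_head[OF sm(1)] by (simp add: hyp0F1_def f_def)
  also have "\<dots> \<le> (\<Sum>k. norm (f (Suc k)))" by (rule summable_norm[OF sm'])
  also have "\<dots> \<le> (\<Sum>k. (1/4) ^ Suc k / fact (Suc k))"
  proof (rule suminf_le[OF bound sm'])
    show "summable (\<lambda>k. (1/4::real) ^ Suc k / fact (Suc k))"
      using summable_exp_real[of "1/4"] summable_Suc_iff[of "\<lambda>k. (1/4::real) ^ k / fact k"] by blast
  qed
  also have "\<dots> = exp (1/4) - 1"
  proof -
    have "exp (1/4) = (\<Sum>k. (1/4::real) ^ k / fact k)"
      unfolding exp_def by (rule suminf_cong) (simp only: real_scaleR_def divide_inverse mult.commute)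
    thus ?thesis using suminf_split_head[OF summable_exp_real[of "1/4"]] by (simp only:) simp
  qed
  also have "\<dots> < 1"
    using exp_half_le2 exp_less_mono[of "1/4" "1/2 :: real"] by linarith
  finally have "hyp0F1 \<beta> z \<noteq> 0" by auto
  thus ?thesis unfolding \<beta>_def ..
qed

lemma gasper_coeff_pos:
  fixes a b :: real
  assumes "a > 0" "b > a + 1/2"
  shows "gasper_coeff a b n > 0"
  unfolding gasper_coeff_def using assms
  by (intro divide_pos_pos mult_pos_pos neumann_coeff_pos pochhammer_pos zero_less_power) auto

text \<open>The square on the right is the term n = 0 of Gasper's series; the other terms are
  nonnegative and at least one is positive.\<close>

lemma hyp1F2_gt_hyp0F1_square:
  fixes a b w :: real
  assumes a: "a > 0" and b: "b > a + 1/2" and w: "w > 0"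
  shows "hyp1F2 a b (a + b - 1/2) (- w) > hyp0F1 b (- w / 4) ^ 2"
proof -
  define f where "f = (\<lambda>n. gasper_coeff a b n * w ^ n * hyp0F1 (b + n) (- w / 4) ^ 2)"
  have sums: "f sums hyp1F2 a b (a + b - 1/2) (- w)"
    unfolding f_def using a b by (intro hyp1F2_gasper_sums) auto
  have sm: "summable (\<lambda>n. f (Suc n))"
    using sums_summable[OF sums] summable_Suc_iff[of f] by blast
  obtain n where "hyp0F1 (b + Suc n) (- w / 4) \<noteq> 0"
    using hyp0F1_eventually_nonzero[of b "- w / 4"] a b by auto
  hence "f (Suc n) > 0"
    unfolding f_def using gasper_coeff_pos[OF a b, of "Suc n"] w by (intro mult_pos_pos) auto
  moreover have "f (Suc k) \<ge> 0" for k
    unfolding f_def using gasper_coeff_pos[OF a b, of "Suc k"] w by (intro mult_nonneg_nonneg) auto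
  ultimately have "0 < (\<Sum>n. f (Suc n))"
    using suminf_pos_iff[OF sm] by blast
  also have "(\<Sum>n. f (Suc n)) = hyp1F2 a b (a + b - 1/2) (- w) - f 0"
    using suminf_split_head[OF sums_summable[OF sums]] sums_unique[OF sums] by simp
  also have "f 0 = hyp0F1 b (- w / 4) ^ 2"
    by (simp add: f_def gasper_coeff_def)
  finally show ?thesis by simp
qed

lemma not_P12_if_le:
  fixes a b :: real
  assumes "a > 0" "b > 0" "b \<le> a + 1/2"
  shows "(a, b, a + b - 1/2) \<notin> P12"
proof
  assume P: "(a, b, a + b - 1/2) \<in> P12"
  \<comment> \<open>Raising both lower parameters by \<open>r\<close> gives a + 1/2 and 2a, the
    boundary case in which the function is a square.\<close>
  define r where "r = a + 1/2 - b"
  have r: "r \<ge> 0" using assms by (simp add: r_def)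
  \<comment> \<open>Membership in \<open>P12\<close> includes positivity of the third parameter,
    which settles a + b \<le> 1/2.\<close>
  have c: "a + b - 1/2 > 0" using P by (simp add: P12_def)
  have pos: "hyp1F2 a b (a + b - 1/2) z > 0" if "z < 0" for z
  proof -
    have "hyp1F2 a b (a + b - 1/2) (- (x ^ 2) / 4) > 0" if "x > 0" for x
      using P that by (simp add: P12_def)
    moreover have "- ((2 * sqrt (- z)) ^ 2) / 4 = z" "2 * sqrt (- z) > 0"
      using that by (simp_all add: power_mult_distrib)
    ultimately show ?thesis by metis
  qed
  have "hyp1F2 a b (a + b - 1/2 + r) z > 0" if "z < 0" for z
    using assms c r pos that by (intro hyp1F2_pos_increase_lower) auto
  hence "hyp1F2 a (a + b - 1/2 + r) b z > 0" if "z < 0" for z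
    using that by (subst hyp1F2_commute)
  hence "hyp1F2 a (a + b - 1/2 + r) (b + r) z > 0" if "z < 0" for z
    using assms c r that by (intro hyp1F2_pos_increase_lower) auto
  moreover have "a + b - 1/2 + r = 2 * (a + 1/2) - 1" "b + r = a + 1/2"
    by (simp_all add: r_def)
  ultimately have pos': "hyp1F2 a (2 * (a + 1/2) - 1) (a + 1/2) z > 0" if "z < 0" for z
    using that by simp
  have square: "hyp1F2 a (2 * (a + 1/2) - 1) (a + 1/2) z = hyp0F1 (a + 1/2) (z / 4) ^ 2" for z
    using hyp1F2_eq_hyp0F1_square[of "a + 1/2" z] assms by (subst hyp1F2_commute) simp
  obtain x where x: "x > 0" "hyp0F1 (a + 1/2) (- (x ^ 2) / 4) = 0"
    using hyp0F1_has_zero[of "a + 1/2"] assms by auto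
  show False
    \<comment> \<open>At z = -x^2 the square is taken at z/4 = -x^2/4, the zero found above.\<close>
    using pos'[of "- (x ^ 2)"] square[of "- (x ^ 2)"] x by simp
qed

theorem theorem4:
  fixes a b :: real
  assumes "a > 0" and "b > 0"
  shows "((a, b, a + b - 1/2) \<in> P12 \<longleftrightarrow> b > a + 1/2) \<and>
         (b > a + 1/2 \<longrightarrow>
            (\<forall>x::real. x > 0 \<longrightarrow>
               hyp1F2 a b (a + b - 1/2) (- (x ^ 2) / 4) > (normJ (b - 1) (x / 2)) ^ 2))"
proof -
  \<comment> \<open>For w = x^2/4, the argument -w/4 equals -(x/2)^2/4, the one inside
    \<open>normJ (b - 1) (x / 2)\<close>.\<close>
  have ineq: "hyp1F2 a b (a + b - 1/2) (- (x ^ 2) / 4) > normJ (b - 1) (x / 2) ^ 2"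
    if "b > a + 1/2" "x > 0" for x :: real
    using hyp1F2_gt_hyp0F1_square[of a b "x ^ 2 / 4"] that \<open>a > 0\<close>
    by (simp add: normJ_def power_divide)
  have "(a, b, a + b - 1/2) \<in> P12" if "b > a + 1/2"
    using ineq[OF that] that assms
    by (auto simp: P12_def intro: le_less_trans[OF zero_le_power2])
  with ineq not_P12_if_le[OF assms] show ?thesis by force
qed

end
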